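(* Let $\mathcal P$ be a $\mathbb K$-linear operad and $f:K\to L$ a lax morphism of lattice operads. Define $f^*:Filt(L,\mathcal P)\to Filt(K,\mathcal P)$ by setting $$(f^*(F\mathcal P))_p\mathcal P(n):=F_{f(p)}\mathcal P(n)$$ for any $L$-filtration $F\mathcal P$, all $n\ge1$ and $p\in K(n)$. Then: (a) $f^*(F\mathcal P)$ is a well-defined $K$-filtration of $\mathcal P$; (b) $(gf)^*=f^*g^*$ for any pair of lax morphisms of lattice operads $K\xrightarrow{f}L\xrightarrow{g}M$.
   Context: A lattice operad is an operad $L=\{L(n)\}_{n\ge1}$ (possibly non-symmetric) in the category of lattices and lattice homomorphisms with the cartesian product: each $L(n)$ is a lattice, each partial composition $\circ_i:L(m)\times L(n)\to L(m+n-1)$, $1\le i\le m$, is a lattice homomorphism, and in the symmetric case the symmetric groups act by lattice homomorphisms. A lax morphism of lattice operads $f:K\to L$ is a family of lattice homomorphisms $f_n:K(n)\to L(n)$, $n\ge1$ (required to be $\mathbb S_n$-equivariant if $K$ and $L$ are symmetric), such that $f(a)\circ_i f(b)\le f(a\circ_i b)$ for all $m,n\ge 1$, $1\le i\le m$, $a\in K(m)$, $b\in K(n)$. An $L$-filtration $F\mathcal P=\{F_p\mathcal P(n)\}_{p\in L(n),n\ge1}$ of a $\mathbb K$-linear operad $\mathcal P$ is a collection of $\mathbb K$-subspaces $F_p\mathcal P(n)\subset\mathcal P(n)$ such that: (i) $F_{p'}\mathcal P(n)\subset F_{p''}\mathcal P(n)$ whenever $p'\le p''$ in $L(n)$; (ii)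 $F_p\mathcal P(n)\cdot\sigma=F_{p\cdot\sigma}\mathcal P(n)$ for $p\in L(n)$, $\sigma\in\mathbb S_n$ (in the symmetric case); (iii) $F_a\mathcal P(m)\circ_iF_b\mathcal P(n)\subset F_{a\circ_ib}\mathcal P(m+n-1)$ for all $a\in L(m)$, $b\in L(n)$, $1\le i\le m$; (iv) if $L(1)$ has a smallest element $\mathbf 0$ and $e\in\mathcal P(1)$ is the operadic unit, if it exists, then $\mathbb K\cdot e\subset F_{\mathbf 0}\mathcal P(1)$. $Filt(L,\mathcal P)$ is the set of all $L$-filtrations of $\mathcal P$.
   Formalization: In (a), condition (iv) for the pullback is claimed only if L(1) has a smallest element whenever P has a unit and K(1) has a smallest element (it can fail otherwise, e.g. for the zero filtration); subspaces and (i)–(iii) hold unconditionally. *)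

theory Defs
  imports "HOL-Algebra.Lattice" "HOL-Algebra.Module" "HOL-Combinatorics.Permutations"
begin

text \<open>
  A collection with arities \<open>n \<ge> 1\<close>: the object \<open>obj P n\<close> (a lattice or a module, with carrier set
  \<open>carrier (obj P n)\<close>), the partial composition \<open>a \<circ>\<^sub>i b = pcomp P m n i a b\<close> of
  \<open>a\<close> of arity \<open>m\<close> with \<open>b\<close> of arity \<open>n\<close>, and the right action \<open>a \<cdot> \<sigma> = sact P n a \<sigma>\<close>.
  Permutations in \<open>\<S>\<^sub>n\<close> are functions \<open>\<sigma>\<close> with \<open>\<sigma> permutes {1..n}\<close>.
\<close>

record ('s, 'a) opdata =
  obj :: "nat \<Rightarrow> 's"
  pcomp :: "nat \<Rightarrow> nat \<Rightarrow> nat \<Rightarrow> 'a \<Rightarrow> 'a \<Rightarrow> 'a"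
  sact :: "nat \<Rightarrow> 'a \<Rightarrow> (nat \<Rightarrow> nat) \<Rightarrow> 'a"

text \<open>
  The permutation \<open>\<tau> \<circ>\<^sub>i \<sigma> \<in> \<S>\<^bsub>m+n-1\<^esub>\<close> obtained by inserting \<open>\<sigma> \<in> \<S>\<^sub>n\<close> at the \<open>i\<close>-th place of
  \<open>\<tau> \<in> \<S>\<^sub>m\<close>: the block \<open>{i..<i+n}\<close> is permuted by \<open>\<sigma>\<close> and moved to start at position \<open>\<tau> i\<close>.
  The convention matches a right action for which \<open>(a \<cdot> \<tau>) (x\<^sub>1, \<dots>, x\<^sub>m)\<close> feeds
  \<open>x\<^sub>k\<close> into slot \<open>\<tau> k\<close> of \<open>a\<close>.
\<close>

definition perm_insert ::
  "nat \<Rightarrow> nat \<Rightarrow> nat \<Rightarrow> (nat \<Rightarrow> nat) \<Rightarrow> (nat \<Rightarrow> nat) \<Rightarrow> nat \<Rightarrow> nat" where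
  "perm_insert m n i \<tau> \<sigma> k =
     (if k \<notin> {1..m + n - 1} then k
      else if k \<in> {i..<i + n} then \<tau> i + \<sigma> (k + 1 - i) - 1
      else let j = (if k < i then k else k + 1 - n)
           in if \<tau> j < \<tau> i then \<tau> j else \<tau> j + n - 1)"

text \<open>
  Set-theoretic axioms of a (not necessarily unital) operad in terms of partial compositions; the
  flag \<open>s\<close> selects symmetric operads, and \<open>sact\<close> is ignored when it is \<open>False\<close>.
\<close>

definition operad_laws ::
  "bool \<Rightarrow> (('a, 'x) partial_object_scheme, 'a, 'y) opdata_scheme \<Rightarrow> bool" where
  "operad_laws s P \<longleftrightarrow>
     (\<forall>m\<ge>1. \<forall>n\<ge>1. \<forall>i\<in>{1..m}. \<forall>a\<in>carrier (obj P m). \<forall>b\<in>carrier (obj P n).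
        pcomp P m n i a b \<in> carrier (obj P (m + n - 1))) \<and>
     (\<forall>m\<ge>1. \<forall>n\<ge>1. \<forall>p\<ge>1. \<forall>i\<in>{1..m}. \<forall>j\<in>{1..n}.
        \<forall>a\<in>carrier (obj P m). \<forall>b\<in>carrier (obj P n). \<forall>c\<in>carrier (obj P p).
        pcomp P (m + n - 1) p (i + j - 1) (pcomp P m n i a b) c =
        pcomp P m (n + p - 1) i a (pcomp P n p j b c)) \<and>
     (\<forall>m\<ge>1. \<forall>n\<ge>1. \<forall>p\<ge>1. \<forall>i\<in>{1..m}. \<forall>k\<in>{i<..m}.
        \<forall>a\<in>carrier (obj P m). \<forall>b\<in>carrier (obj P n). \<forall>c\<in>carrier (obj P p).
        pcomp P (m + n - 1) p (k + n - 1) (pcomp P m n i a b) c =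
        pcomp P (m + p - 1) n i (pcomp P m p k a c) b) \<and>
     (s \<longrightarrow>
        (\<forall>n\<ge>1. \<forall>a\<in>carrier (obj P n).
           sact P n a id = a \<and>
           (\<forall>\<sigma>. \<sigma> permutes {1..n} \<longrightarrow> sact P n a \<sigma> \<in> carrier (obj P n) \<and>
              (\<forall>\<tau>. \<tau> permutes {1..n} \<longrightarrow>
                 sact P n (sact P n a \<sigma>) \<tau> = sact P n a (\<sigma> \<circ> \<tau>)))) \<and>
        (\<forall>m\<ge>1. \<forall>n\<ge>1. \<forall>i\<in>{1..m}. \<forall>a\<in>carrier (obj P m). \<forall>b\<in>carrier (obj P n).
           \<forall>\<tau> \<sigma>. \<tau> permutes {1..m} \<and> \<sigma> permutes {1..n} \<longrightarrow>
             pcomp P m n i (sact P m a \<tau>) (sact P n b \<sigma>) =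
             sact P (m + n - 1) (pcomp P m n (\<tau> i) a b) (perm_insert m n i \<tau> \<sigma>)))"

definition operadic_unit ::
  "(('a, 'x) partial_object_scheme, 'a, 'y) opdata_scheme \<Rightarrow> 'a \<Rightarrow> bool" where
  "operadic_unit P e \<longleftrightarrow> e \<in> carrier (obj P 1) \<and>
     (\<forall>n\<ge>1. \<forall>a\<in>carrier (obj P n).
        pcomp P 1 n 1 e a = a \<and> (\<forall>i\<in>{1..n}. pcomp P n 1 i a e = a))"


definition linear_map_on ::
  "('k, 'r) ring_scheme \<Rightarrow> ('k, 'p, 'u) module_scheme \<Rightarrow> ('k, 'q, 'v) module_scheme \<Rightarrow>
   ('p \<Rightarrow> 'q) \<Rightarrow> bool" where
  "linear_map_on R V W h \<longleftrightarrow> h \<in> carrier V \<rightarrow> carrier W \<and>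
     (\<forall>x\<in>carrier V. \<forall>y\<in>carrier V. h (x \<oplus>\<^bsub>V\<^esub> y) = h x \<oplus>\<^bsub>W\<^esub> h y) \<and>
     (\<forall>r\<in>carrier R. \<forall>x\<in>carrier V. h (r \<odot>\<^bsub>V\<^esub> x) = r \<odot>\<^bsub>W\<^esub> h x)"

definition linear_operad ::
  "bool \<Rightarrow> ('k, 'r) ring_scheme \<Rightarrow> (('k, 'p, 'u) module_scheme, 'p, 'y) opdata_scheme \<Rightarrow> bool"
  where
  "linear_operad s R P \<longleftrightarrow>
     operad_laws s P \<and>
     (\<forall>n\<ge>1. module R (obj P n)) \<and>
     (\<forall>m\<ge>1. \<forall>n\<ge>1. \<forall>i\<in>{1..m}.
        (\<forall>b\<in>carrier (obj P n).
           linear_map_on R (obj P m) (obj P (m + n - 1)) (\<lambda>a. pcomp P m n i a b)) \<and>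
        (\<forall>a\<in>carrier (obj P m).
           linear_map_on R (obj P n) (obj P (m + n - 1)) (\<lambda>b. pcomp P m n i a b))) \<and>
     (s \<longrightarrow> (\<forall>n\<ge>1. \<forall>\<sigma>. \<sigma> permutes {1..n} \<longrightarrow>
        linear_map_on R (obj P n) (obj P n) (\<lambda>a. sact P n a \<sigma>)))"


definition lattice_hom ::
  "('a, 'x) gorder_scheme \<Rightarrow> ('b, 'y) gorder_scheme \<Rightarrow> ('a \<Rightarrow> 'b) \<Rightarrow> bool" where
  "lattice_hom A B h \<longleftrightarrow> h \<in> carrier A \<rightarrow> carrier B \<and> join_pres A B h \<and> meet_pres A B h"

definition prod_gorder ::
  "('a, 'x) gorder_scheme \<Rightarrow> ('b, 'y) gorder_scheme \<Rightarrow> ('a \<times> 'b) gorder" where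
  "prod_gorder A B =
     \<lparr>carrier = carrier A \<times> carrier B, eq = (=),
      le = (\<lambda>u v. fst u \<sqsubseteq>\<^bsub>A\<^esub> fst v \<and> snd u \<sqsubseteq>\<^bsub>B\<^esub> snd v)\<rparr>"

definition lattice_operad ::
  "bool \<Rightarrow> (('a, 'x) gorder_scheme, 'a, 'y) opdata_scheme \<Rightarrow> bool" where
  "lattice_operad s L \<longleftrightarrow>
     operad_laws s L \<and>
     (\<forall>n\<ge>1. lattice (obj L n)) \<and>
     (\<forall>m\<ge>1. \<forall>n\<ge>1. \<forall>i\<in>{1..m}.
        lattice_hom (prod_gorder (obj L m) (obj L n)) (obj L (m + n - 1))
          (\<lambda>(a, b). pcomp L m n i a b)) \<and>
     (s \<longrightarrow> (\<forall>n\<ge>1. \<forall>\<sigma>. \<sigma> permutes {1..n} \<longrightarrow>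
        lattice_hom (obj L n) (obj L n) (\<lambda>a. sact L n a \<sigma>)))"

definition lax_morphism ::
  "bool \<Rightarrow> (('a, 'x) gorder_scheme, 'a, 'y) opdata_scheme \<Rightarrow>
   (('b, 'z) gorder_scheme, 'b, 'w) opdata_scheme \<Rightarrow> (nat \<Rightarrow> 'a \<Rightarrow> 'b) \<Rightarrow> bool" where
  "lax_morphism s K L f \<longleftrightarrow>
     (\<forall>n\<ge>1. lattice_hom (obj K n) (obj L n) (f n)) \<and>
     (s \<longrightarrow> (\<forall>n\<ge>1. \<forall>a\<in>carrier (obj K n). \<forall>\<sigma>. \<sigma> permutes {1..n} \<longrightarrow>
        f n (sact K n a \<sigma>) = sact L n (f n a) \<sigma>)) \<and>
     (\<forall>m\<ge>1. \<forall>n\<ge>1. \<forall>i\<in>{1..m}. \<forall>a\<in>carrier (obj K m). \<forall>b\<in>carrier (obj K n).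
        pcomp L m n i (f m a) (f n b) \<sqsubseteq>\<^bsub>obj L (m + n - 1)\<^esub> f (m + n - 1) (pcomp K m n i a b))"


text \<open>
  A family \<open>{F\<^sub>p P(n)}\<close> is a function on the pairs \<open>(n, p)\<close> with \<open>n \<ge> 1\<close> and \<open>p \<in> L(n)\<close>. Requiring
  it to be extensional (that is, \<open>undefined\<close> off that index set) makes equality of families the
  usual one.
\<close>

definition indices :: "(('a, 'x) gorder_scheme, 'a, 'y) opdata_scheme \<Rightarrow> (nat \<times> 'a) set" where
  "indices L = (SIGMA n:{1..}. carrier (obj L n))"

text \<open>
  Everything required of a filtration except the condition on the operadic unit of \<open>P\<close>.
\<close>

definition prefiltration ::
  "bool \<Rightarrow> ('k, 'r) ring_scheme \<Rightarrow> (('a, 'x) gorder_scheme, 'a, 'y) opdata_scheme \<Rightarrow>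
   (('k, 'p, 'u) module_scheme, 'p, 'v) opdata_scheme \<Rightarrow> (nat \<times> 'a \<Rightarrow> 'p set) \<Rightarrow> bool" where
  "prefiltration s R L P F \<longleftrightarrow>
     F \<in> extensional (indices L) \<and>
     (\<forall>n\<ge>1. \<forall>p\<in>carrier (obj L n). submodule (F (n, p)) R (obj P n)) \<and>
     (\<forall>n\<ge>1. \<forall>p\<in>carrier (obj L n). \<forall>q\<in>carrier (obj L n).
        p \<sqsubseteq>\<^bsub>obj L n\<^esub> q \<longrightarrow> F (n, p) \<subseteq> F (n, q)) \<and>
     (s \<longrightarrow> (\<forall>n\<ge>1. \<forall>p\<in>carrier (obj L n). \<forall>\<sigma>. \<sigma> permutes {1..n} \<longrightarrow>
        (\<lambda>x. sact P n x \<sigma>) ` F (n, p) = F (n, sact L n p \<sigma>))) \<and>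
     (\<forall>m\<ge>1. \<forall>n\<ge>1. \<forall>i\<in>{1..m}. \<forall>a\<in>carrier (obj L m). \<forall>b\<in>carrier (obj L n).
        \<forall>x\<in>F (m, a). \<forall>y\<in>F (n, b).
          pcomp P m n i x y \<in> F (m + n - 1, pcomp L m n i a b))"

definition Filt ::
  "bool \<Rightarrow> ('k, 'r) ring_scheme \<Rightarrow> (('a, 'x) gorder_scheme, 'a, 'y) opdata_scheme \<Rightarrow>
   (('k, 'p, 'u) module_scheme, 'p, 'v) opdata_scheme \<Rightarrow> (nat \<times> 'a \<Rightarrow> 'p set) set" where
  "Filt s R L P = {F. prefiltration s R L P F \<and>
     (\<forall>z e. least (obj L 1) z (carrier (obj L 1)) \<and> operadic_unit P e \<longrightarrow>
        {r \<odot>\<^bsub>obj P 1\<^esub> e | r. r \<in> carrier R} \<subseteq> F (1, z))}"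

definition pullback ::
  "(('a, 'x) gorder_scheme, 'a, 'y) opdata_scheme \<Rightarrow> (nat \<Rightarrow> 'a \<Rightarrow> 'b) \<Rightarrow>
   (nat \<times> 'b \<Rightarrow> 'p set) \<Rightarrow> nat \<times> 'a \<Rightarrow> 'p set" where
  "pullback K f F = (\<lambda>(n, p)\<in>indices K. F (n, f n p))"

end

theory Submission
  imports Defs
begin

text \<open>Pulling back relabels the subspaces along \<open>f\<close>, so each axiom for the new
  family is an axiom for \<open>F\<close> at the image labels, once \<open>f\<close> is known to be
  monotone; it is, because it preserves joins. Compatibility with composition is where laxity
  enters: a composite from F_{f(a)} and F_{f(b)} lies in the piece labelled f(a) \<circ>_i f(b)
  \<le> f(a \<circ>_i b), and \<open>F\<close> grows with its label
  (\<open>prefiltration_pullback\<close>). If z is smallest in K(1), the unit lies in the piece of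
  the smallest element of L(1), hence in that of f(z); this argument presupposes that L(1) has a
  smallest element, whence the proviso in \<open>Filt_pullback\<close>. Functoriality holds label by
  label, both sides being F_{g(f(p))} (\<open>pullback_comp\<close>), and
  \<open>lax_morphism_comp\<close> shows that gf is again lax.\<close>

lemma lattice_hom_mono:
  assumes "lattice_hom A B h" "x \<in> carrier A" "y \<in> carrier A" "x \<sqsubseteq>\<^bsub>A\<^esub> y"
  shows "h x \<sqsubseteq>\<^bsub>B\<^esub> h y"
  using assms join_pres_isotone[of h A B] by (simp add: lattice_hom_def isotone_def)

lemma lattice_hom_comp:
  assumes "lattice_hom A B h" "lattice_hom B C k"
  shows "lattice_hom A C (k \<circ> h)"
  using assms unfolding lattice_hom_def join_pres_def meet_pres_def
  by (auto simp: Pi_iff)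

lemma lax_morphism_lattice_hom:
  "\<lbrakk>lax_morphism s K L f; n \<ge> 1\<rbrakk> \<Longrightarrow> lattice_hom (obj K n) (obj L n) (f n)"
  by (simp add: lax_morphism_def)

lemma lax_morphism_closed:
  "\<lbrakk>lax_morphism s K L f; n \<ge> 1; p \<in> carrier (obj K n)\<rbrakk> \<Longrightarrow> f n p \<in> carrier (obj L n)"
  by (auto simp: lax_morphism_def lattice_hom_def)

lemma lax_morphism_sact:
  "\<lbrakk>lax_morphism s K L f; s; n \<ge> 1; a \<in> carrier (obj K n); \<sigma> permutes {1..n}\<rbrakk>
    \<Longrightarrow> f n (sact K n a \<sigma>) = sact L n (f n a) \<sigma>"
  by (simp add: lax_morphism_def)

lemma lax_morphism_pcomp:
  "\<lbrakk>lax_morphism s K L f; m \<ge> 1; n \<ge> 1; i \<in> {1..m};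
    a \<in> carrier (obj K m); b \<in> carrier (obj K n)\<rbrakk>
    \<Longrightarrow> pcomp L m n i (f m a) (f n b) \<sqsubseteq>\<^bsub>obj L (m + n - 1)\<^esub> f (m + n - 1) (pcomp K m n i a b)"
  by (simp add: lax_morphism_def)

lemma lattice_operad_lattice: "\<lbrakk>lattice_operad s L; n \<ge> 1\<rbrakk> \<Longrightarrow> lattice (obj L n)"
  by (simp add: lattice_operad_def)

lemma lattice_operad_pcomp_closed:
  "\<lbrakk>lattice_operad s L; m \<ge> 1; n \<ge> 1; i \<in> {1..m};
    a \<in> carrier (obj L m); b \<in> carrier (obj L n)\<rbrakk>
    \<Longrightarrow> pcomp L m n i a b \<in> carrier (obj L (m + n - 1))"
  by (simp add: lattice_operad_def operad_laws_def)

lemma lattice_operad_sact_closed: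
  assumes "lattice_operad s L" "s" "n \<ge> 1" "a \<in> carrier (obj L n)" "\<sigma> permutes {1..n}"
  shows "sact L n a \<sigma> \<in> carrier (obj L n)"
proof -
  have "lattice_hom (obj L n) (obj L n) (\<lambda>a. sact L n a \<sigma>)"
    using assms by (simp add: lattice_operad_def)
  then show ?thesis using assms(4) by (auto simp: lattice_hom_def)
qed

lemma lax_morphism_mono:
  assumes "lax_morphism s K L f" "n \<ge> 1"
    and "p \<in> carrier (obj K n)" "q \<in> carrier (obj K n)" "p \<sqsubseteq>\<^bsub>obj K n\<^esub> q"
  shows "f n p \<sqsubseteq>\<^bsub>obj L n\<^esub> f n q"
  using lattice_hom_mono[OF lax_morphism_lattice_hom[OF assms(1,2)] assms(3-5)] .

text \<open>Laxity of g, then g applied to laxity of f, gives g(f(a)) \<circ>_i g(f(b)) \<le> g(f(a)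
  \<circ>_i f(b)) \<le> g(f(a \<circ>_i b)). Equivariance and the homomorphism property compose
  directly.\<close>

lemma lax_morphism_comp:
  assumes K: "lattice_operad s K" and L: "lattice_operad s L" and M: "lattice_operad s M"
    and f: "lax_morphism s K L f" and g: "lax_morphism s L M g"
  shows "lax_morphism s K M (\<lambda>n. g n \<circ> f n)"
proof -
  have "pcomp M m n i ((g m \<circ> f m) a) ((g n \<circ> f n) b)
      \<sqsubseteq>\<^bsub>obj M (m + n - 1)\<^esub> (g (m + n - 1) \<circ> f (m + n - 1)) (pcomp K m n i a b)"
    if h: "m \<ge> 1" "n \<ge> 1" "i \<in> {1..m}" "a \<in> carrier (obj K m)" "b \<in> carrier (obj K n)"
    for m n i a b
  proof -
    \<comment> \<open>All facts about lattices and morphisms are restricted to positive arities, so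
      the arity of the composite has to be checked too.\<close>
    have ar: "m + n - 1 \<ge> 1" using h(1,2) by linarith
    interpret M: lattice "obj M (m + n - 1)" by (rule lattice_operad_lattice[OF M ar])
    note fa = lax_morphism_closed[OF f h(1) h(4)] and fb = lax_morphism_closed[OF f h(2) h(5)]
    note ab = lattice_operad_pcomp_closed[OF K h]
    note fab = lattice_operad_pcomp_closed[OF L h(1-3) fa fb]
    note gfab = lattice_operad_pcomp_closed[OF M h(1-3)
        lax_morphism_closed[OF g h(1) fa] lax_morphism_closed[OF g h(2) fb]]
    have "g (m + n - 1) (pcomp L m n i (f m a) (f n b))
        \<sqsubseteq>\<^bsub>obj M (m + n - 1)\<^esub> g (m + n - 1) (f (m + n - 1) (pcomp K m n i a b))"
      by (rule lax_morphism_mono[OF g ar fab lax_morphism_closed[OF f ar ab]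
            lax_morphism_pcomp[OF f h]])
    with lax_morphism_pcomp[OF g h(1-3) fa fb] show ?thesis
      unfolding comp_apply
      by (rule M.le_trans[OF _ _ gfab lax_morphism_closed[OF g ar fab]
            lax_morphism_closed[OF g ar lax_morphism_closed[OF f ar ab]]])
  qed
  moreover have "(g n \<circ> f n) (sact K n a \<sigma>) = sact M n ((g n \<circ> f n) a) \<sigma>"
    if "s" "n \<ge> 1" "a \<in> carrier (obj K n)" "\<sigma> permutes {1..n}" for n a \<sigma>
    using that lax_morphism_sact[OF f] lax_morphism_sact[OF g] lax_morphism_closed[OF f] by simp
  ultimately show ?thesis
    using lattice_hom_comp[OF lax_morphism_lattice_hom[OF f] lax_morphism_lattice_hom[OF g]]
    unfolding lax_morphism_def by (intro conjI allI impI ballI) assumption+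
qed

lemma pullback_apply [simp]:
  "\<lbrakk>n \<ge> 1; p \<in> carrier (obj K n)\<rbrakk> \<Longrightarrow> pullback K f F (n, p) = F (n, f n p)"
  by (simp add: pullback_def indices_def)

lemma pullback_extensional: "pullback K f F \<in> extensional (indices K)"
  by (simp add: pullback_def)

text \<open>Inside \<open>indices K\<close>, the label f(p) lies in the carrier of L(n), so the
  inner pullback is evaluated where it is defined; outside, both sides are \<open>undefined\<close>
  by extensionality.\<close>

lemma pullback_comp:
  assumes "lax_morphism s K L f"
  shows "pullback K (\<lambda>n. g n \<circ> f n) F = pullback K f (pullback L g F)"
proof (rule extensionalityI[OF pullback_extensional pullback_extensional])
  fix x assume "x \<in> indices K"
  then show "pullback K (\<lambda>n. g n \<circ> f n) F x = pullback K f (pullback L g F) x"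
    using lax_morphism_closed[OF assms] by (auto simp: indices_def)
qed

lemma prefiltrationD:
  assumes "prefiltration s R L P F"
  shows prefiltration_submodule:
      "\<lbrakk>n \<ge> 1; p \<in> carrier (obj L n)\<rbrakk> \<Longrightarrow> submodule (F (n, p)) R (obj P n)"
    and prefiltration_mono:
      "\<lbrakk>n \<ge> 1; p \<in> carrier (obj L n); q \<in> carrier (obj L n); p \<sqsubseteq>\<^bsub>obj L n\<^esub> q\<rbrakk>
        \<Longrightarrow> F (n, p) \<subseteq> F (n, q)"
    and prefiltration_sact:
      "\<lbrakk>s; n \<ge> 1; p \<in> carrier (obj L n); \<sigma> permutes {1..n}\<rbrakk>
        \<Longrightarrow> (\<lambda>x. sact P n x \<sigma>) ` F (n, p) = F (n, sact L n p \<sigma>)"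
    and prefiltration_pcomp:
      "\<lbrakk>m \<ge> 1; n \<ge> 1; i \<in> {1..m}; a \<in> carrier (obj L m); b \<in> carrier (obj L n);
        x \<in> F (m, a); y \<in> F (n, b)\<rbrakk>
        \<Longrightarrow> pcomp P m n i x y \<in> F (m + n - 1, pcomp L m n i a b)"
  using assms by (simp_all add: prefiltration_def)

lemma prefiltration_pullback:
  assumes K: "lattice_operad s K" and L: "lattice_operad s L" and f: "lax_morphism s K L f"
    and F: "prefiltration s R L P F"
  shows "prefiltration s R K P (pullback K f F)"
proof -
  note fc = lax_morphism_closed[OF f]
  have sub: "submodule (pullback K f F (n, p)) R (obj P n)"
    if "n \<ge> 1" "p \<in> carrier (obj K n)" for n p
    using that prefiltration_submodule[OF F] fc by simp
  have mono: "pullback K f F (n, p) \<subseteq> pullback K f F (n, q)"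
    if "n \<ge> 1" "p \<in> carrier (obj K n)" "q \<in> carrier (obj K n)" "p \<sqsubseteq>\<^bsub>obj K n\<^esub> q" for n p q
    using that prefiltration_mono[OF F] fc lax_morphism_mono[OF f] by simp
  \<comment> \<open>Closure of K(n) under the action allows the right side to be unfolded to
    \<open>F\<close> at f(p\<sigma>), which equals f(p)\<sigma> by equivariance.\<close>
  have sact: "(\<lambda>x. sact P n x \<sigma>) ` pullback K f F (n, p) = pullback K f F (n, sact K n p \<sigma>)"
    if "s" "n \<ge> 1" "p \<in> carrier (obj K n)" "\<sigma> permutes {1..n}" for n p \<sigma>
    using that prefiltration_sact[OF F] fc lax_morphism_sact[OF f] lattice_operad_sact_closed[OF K]
    by simp
  have pcomp: "pcomp P m n i x y \<in> pullback K f F (m + n - 1, pcomp K m n i a b)"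
    if h: "m \<ge> 1" "n \<ge> 1" "i \<in> {1..m}" "a \<in> carrier (obj K m)" "b \<in> carrier (obj K n)"
      and x: "x \<in> pullback K f F (m, a)" and y: "y \<in> pullback K f F (n, b)" for m n i a b x y
  proof -
    have ar: "m + n - 1 \<ge> 1" using h(1,2) by linarith
    note fa = fc[OF h(1) h(4)] and fb = fc[OF h(2) h(5)]
    note ab = lattice_operad_pcomp_closed[OF K h]
    have "pcomp P m n i x y \<in> F (m + n - 1, pcomp L m n i (f m a) (f n b))"
      using x y h by (intro prefiltration_pcomp[OF F h(1-3) fa fb]) simp_all
    \<comment> \<open>The inequality of a lax morphism points in exactly the direction in which
      \<open>F\<close> increases.\<close>
    also have "\<dots> \<subseteq> F (m + n - 1, f (m + n - 1) (pcomp K m n i a b))"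
      by (rule prefiltration_mono[OF F ar lattice_operad_pcomp_closed[OF L h(1-3) fa fb]
            fc[OF ar ab] lax_morphism_pcomp[OF f h]])
    finally show ?thesis by (simp only: pullback_apply[OF ar ab])
  qed
  show ?thesis
    unfolding prefiltration_def
    by (intro conjI allI impI ballI pullback_extensional; (rule sub mono sact pcomp; assumption))
qed

text \<open>
  Condition (iv) is the only one that can fail to pull back: it says nothing about \<open>F\<close> unless
  \<open>L(1)\<close> has a smallest element, whereas \<open>K(1)\<close> may have one regardless.
\<close>

lemma Filt_pullback:
  assumes K: "lattice_operad s K" and L: "lattice_operad s L" and f: "lax_morphism s K L f"
    and F: "F \<in> Filt s R L P"
    and least: "\<lbrakk>\<exists>e. operadic_unit P e; \<exists>z. least (obj K 1) z (carrier (obj K 1))\<rbrakk>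
      \<Longrightarrow> \<exists>z. least (obj L 1) z (carrier (obj L 1))"
  shows "pullback K f F \<in> Filt s R K P"
proof -
  have pre: "prefiltration s R L P F" using F by (simp add: Filt_def)
  have "{r \<odot>\<^bsub>obj P 1\<^esub> e | r. r \<in> carrier R} \<subseteq> pullback K f F (1, z)"
    if z: "least (obj K 1) z (carrier (obj K 1))" and e: "operadic_unit P e" for z e
  proof -
    \<comment> \<open>A lattice homomorphism need not send a smallest element to a smallest element,
      so \<open>f 1 z\<close> cannot serve as \<open>w\<close>; only \<open>w\<close> \<le>
      \<open>f 1 z\<close> is available, and it suffices.\<close>
    obtain w where w: "least (obj L 1) w (carrier (obj L 1))"
      using least z e by blast
    have zc: "z \<in> carrier (obj K 1)" and wc: "w \<in> carrier (obj L 1)"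
      using z w by (auto simp: least_def)
    have fz: "f 1 z \<in> carrier (obj L 1)" using lax_morphism_closed[OF f] zc by simp
    have "{r \<odot>\<^bsub>obj P 1\<^esub> e | r. r \<in> carrier R} \<subseteq> F (1, w)"
      using F w e unfolding Filt_def by blast
    also have "\<dots> \<subseteq> F (1, f 1 z)"
      using prefiltration_mono[OF pre _ wc fz] w fz by (simp add: least_def)
    finally show ?thesis using zc by simp
  qed
  with prefiltration_pullback[OF K L f pre] show ?thesis
    unfolding Filt_def by blast
qed

theorem theorem6p1:
  fixes s :: bool
    and R :: "'k ring"
    and P :: "(('k, 'p) module, 'p) opdata"
    and K :: "('a gorder, 'a) opdata"
    and L :: "('b gorder, 'b) opdata"
    and f :: "nat \<Rightarrow> 'a \<Rightarrow> 'b"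
  assumes "field R"
    and "linear_operad s R P"
    and "lattice_operad s K"
    and "lattice_operad s L"
    and "lax_morphism s K L f"
  shows
    "(\<forall>F\<in>Filt s R L P.
        prefiltration s R K P (pullback K f F) \<and>
        (((\<exists>e. operadic_unit P e) \<and> (\<exists>z. least (obj K 1) z (carrier (obj K 1))) \<longrightarrow>
          (\<exists>z. least (obj L 1) z (carrier (obj L 1)))) \<longrightarrow>
         pullback K f F \<in> Filt s R K P)) \<and>
     (\<forall>(M :: ('c gorder, 'c) opdata) (g :: nat \<Rightarrow> 'b \<Rightarrow> 'c).
        lattice_operad s M \<and> lax_morphism s L M g \<longrightarrow>
        lax_morphism s K M (\<lambda>n. g n \<circ> f n) \<and>
        (\<forall>F\<in>Filt s R M P.
          pullback K (\<lambda>n. g n \<circ> f n) F = pullback K f (pullback L g F)))"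
proof (intro conjI ballI allI impI; (elim conjE)?)
  fix F assume F: "F \<in> Filt s R L P"
  then show "prefiltration s R K P (pullback K f F)"
    by (intro prefiltration_pullback[OF assms(3-5)]) (simp add: Filt_def)
  assume "(\<exists>e. operadic_unit P e) \<and> (\<exists>z. least (obj K 1) z (carrier (obj K 1))) \<longrightarrow>
    (\<exists>z. least (obj L 1) z (carrier (obj L 1)))"
  then show "pullback K f F \<in> Filt s R K P"
    by (intro Filt_pullback[OF assms(3-5) F]) blast
next
  \<comment> \<open>Laxity of gf is what makes the pullback along gf meaningful; the equation of
    pullbacks is left to the closing rule.\<close>
  fix M :: "('c gorder, 'c) opdata" and g :: "nat \<Rightarrow> 'b \<Rightarrow> 'c"
  assume "lattice_operad s M" "lax_morphism s L M g"
  then show "lax_morphism s K M (\<lambda>n. g n \<circ> f n)"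
    by (rule lax_morphism_comp[OF assms(3,4) _ assms(5)])
qed (rule pullback_comp[OF assms(5)])

end
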